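(* Let $c\geq 2$ be an odd integer and let $0\leq a<c$ be an integer. Then \[ \overline{N}_2(a,c,n_1)\,\overline{N}_2(a,c,n_2)>\overline{N}_2(a,c,n_1+n_2) \] for all sufficiently large $n_1$ and $n_2$.
   Context: An overpartition of a nonnegative integer $n$ is a partition of $n$ in which the first occurrence of each distinct part may be overlined. For an overpartition $\lambda$, let $l(\lambda)$ be its largest part, $n(\lambda)$ its number of parts, and $n(\lambda_o)$ its number of odd non-overlined parts; let $\chi(\lambda)=1$ if $l(\lambda)$ is odd and non-overlined, and $\chi(\lambda)=0$ otherwise. The $M_2$-rank of $\lambda$ is $\lceil l(\lambda)/2\rceil-n(\lambda)-n(\lambda_o)-\chi(\lambda)$. $\overline{N}_2(a,c,n)$ denotes the number of overpartitions of $n$ whose $M_2$-rank is congruent to $a$ modulo $c$. *)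

theory Defs
  imports Complex_Main "HOL-Library.Multiset" "HOL-Number_Theory.Cong"
begin

text \<open>
  An overpartition is encoded as a pair of the underlying partition, a multiset of
  positive integers, and the set of those distinct parts whose first occurrence is overlined.
\<close>

type_synonym overpartition = "nat multiset \<times> nat set"

definition overpartitions :: "nat \<Rightarrow> overpartition set" where
  "overpartitions n = {(M, S). 0 \<notin># M \<and> sum_mset M = n \<and> S \<subseteq> set_mset M}"

text \<open>The empty overpartition, which has no largest part, gets the value 0.\<close>

definition largest_part :: "overpartition \<Rightarrow> nat" where
  "largest_part p = Max (insert 0 (set_mset (fst p)))"

definition num_parts :: "overpartition \<Rightarrow> nat" where
  "num_parts p = size (fst p)"

definition nonoverlined_parts :: "overpartition \<Rightarrow> nat multiset" where
  "nonoverlined_parts p = fst p - mset_set (snd p)"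

definition num_odd_nonoverlined :: "overpartition \<Rightarrow> nat" where
  "num_odd_nonoverlined p = size (filter_mset odd (nonoverlined_parts p))"

text \<open>
  The largest part is the first entry when the parts are listed in nonincreasing order. As it is
  the first occurrence that carries the overline, the largest part is non-overlined
  iff its value does not occur overlined at all.
\<close>

definition chi :: "overpartition \<Rightarrow> nat" where
  "chi p = (if odd (largest_part p) \<and> largest_part p \<notin> snd p then 1 else 0)"

text \<open>
  The term \<open>num_odd_nonoverlined\<close> is subtracted, following the definition formalized here;
  Lovejoy's original M2-rank adds it.
\<close>

definition M2_rank :: "overpartition \<Rightarrow> int" where
  "M2_rank p = \<lceil>real (largest_part p) / 2\<rceil> - int (num_parts p)
     - int (num_odd_nonoverlined p) - int (chi p)"

definition N2_bar :: "int \<Rightarrow> int \<Rightarrow> nat \<Rightarrow> nat" where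
  "N2_bar a c n = card {p \<in> overpartitions n. [M2_rank p = a] (mod c)}"

lemma size_le_sum_mset:
  fixes M :: "nat multiset"
  shows "0 \<notin># M \<Longrightarrow> size M \<le> sum_mset M"
  by (induction M) auto

lemma finite_overpartitions: "finite (overpartitions n)"
proof -
  have "overpartitions n \<subseteq> (\<Union>k\<le>n. multisets_of_size {..n} k) \<times> Pow {..n}"
    (is "_ \<subseteq> ?B")
  proof
    fix p assume "p \<in> overpartitions n"
    then obtain M S where p: "p = (M, S)" "0 \<notin># M" "sum_mset M = n" "S \<subseteq> set_mset M"
      by (auto simp: overpartitions_def)
    have "x \<le> n" if "x \<in># M" for x
      using p(3) sum_mset.remove[OF that] by simp
    then show "p \<in> ?B"
      using p size_le_sum_mset[of M] by (auto simp: multisets_of_size_def)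
  qed
  moreover have "finite ?B"
    by (intro finite_cartesian_product finite_UN_I) auto
  ultimately show ?thesis
    by (rule finite_subset)
qed

end

theory Submission
  imports Defs "HOL-Library.FuncSet"
begin

text \<open>
  Let \<open>pbar n\<close> be the number of overpartitions of \<open>n\<close>. Adding \<open>c\<close> plain fours to an
  overpartition of \<open>n - 4c\<close> and trading \<open>j < c\<close> of them for \<open>2j\<close> plain twos reaches every rank
  class modulo \<open>c\<close>, so \<open>pbar (n - 4c) \<le> c N2_bar a c n\<close>. As \<open>pbar (n + 1) \<le> 4 pbar n\<close>, it remains
  to see that \<open>pbar n1 * pbar n2 / pbar (n1 + n2)\<close> tends to infinity with
  \<open>n1 \<le> n2\<close>. List the parts of an overpartition of \<open>n1 + n2\<close> in descending order and
  cut the list at sum \<open>n1\<close>, splitting the part \<open>z\<close> that straddles the cut into \<open>u + v\<close>.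
  If \<open>v\<close> is large, it can be replaced by ones and twos in many ways; if \<open>u\<close> is large,
  it can be broken into two parts in many ways; in both cases only boundedly many
  overpartitions lead to the same pair. If both are small, all parts after the cut are bounded,
  which leaves polynomially many choices for them, whereas \<open>pbar n2\<close> grows faster than any polynomial.
\<close>

section \<open>Coding overpartitions as multisets of natural numbers\<close>

text \<open>
  An overpartition is coded as one multiset: a plain part \<open>k\<close> becomes \<open>2 * k\<close> and an
  overlined part \<open>k\<close> becomes \<open>2 * k + 1\<close>. This orders the parts linearly, and every plain
  part smaller than \<open>z\<close> has a code below both codes of \<open>z\<close>.
\<close>

definition weight :: "nat multiset \<Rightarrow> nat" where
  "weight C = (\<Sum>c\<in>#C. c div 2)"

lemma weight_simps [simp]:
  "weight {#} = 0" "weight (add_mset c C) = c div 2 + weight C" "weight (A + B) = weight A + weight B"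
  "weight (replicate_mset k c) = k * (c div 2)"
  by (simp_all add: weight_def)

definition coded :: "nat multiset \<Rightarrow> bool" where
  "coded C \<longleftrightarrow> (\<forall>c\<in>#C. 2 \<le> c) \<and> (\<forall>c. odd c \<longrightarrow> count C c \<le> 1)"

text \<open>
  Plain parts 1 and 2 are set aside: they are the filler whose \<open>k div 2 + 1\<close> arrangements of
  total \<open>k\<close> provide the gain in the main estimate.
\<close>

definition core :: "nat multiset \<Rightarrow> bool" where
  "core C \<longleftrightarrow> coded C \<and> 2 \<notin># C \<and> 4 \<notin># C"

definition encode :: "overpartition \<Rightarrow> nat multiset" where
  "encode p = image_mset (\<lambda>k. 2 * k) (fst p - mset_set (snd p))
     + image_mset (\<lambda>k. 2 * k + 1) (mset_set (snd p))"

definition decode :: "nat multiset \<Rightarrow> overpartition" where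
  "decode C = (image_mset (\<lambda>c. c div 2) C, (\<lambda>c. c div 2) ` {c \<in> set_mset C. odd c})"

lemma mset_set_subseteq: "S \<subseteq> set_mset M \<Longrightarrow> mset_set S \<subseteq># M"
  by (metis finite_set_mset mset_set_set_mset_msubset subset_imp_msubset_mset_set subset_mset.order_trans)

text \<open>Halving a code forgets only the overline bit. Odd codes are simple and have distinct
  halves, so the overlined parts form a set and \<open>decode\<close> inverts \<open>encode\<close>
  on both sides.\<close>

lemma bij_betw_encode: "bij_betw encode (overpartitions n) {C. coded C \<and> weight C = n}"
proof (rule bij_betw_byWitness[where f' = decode])
  show "\<forall>p\<in>overpartitions n. decode (encode p) = p"
  proof
    fix p assume "p \<in> overpartitions n"
    then obtain M S where p: "p = (M, S)" "0 \<notin># M" "S \<subseteq> set_mset M"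
      by (auto simp: overpartitions_def)
    have fin: "finite S" using p(3) finite_subset by blast
    have sub: "mset_set S \<subseteq># M" using mset_set_subseteq p(3) by blast
    have "fst (decode (encode p)) = M"
      using sub by (simp add: decode_def encode_def p multiset.map_comp o_def)
    moreover have "{c \<in> set_mset (encode p). odd c} = (\<lambda>k. 2 * k + 1) ` S"
      using fin by (auto simp: encode_def p)
    then have "snd (decode (encode p)) = S"
      by (simp add: decode_def image_image)
    ultimately show "decode (encode p) = p" by (simp add: p prod_eq_iff)
  qed
  show "\<forall>C\<in>{C. coded C \<and> weight C = n}. encode (decode C) = C"
  proof
    fix C assume "C \<in> {C. coded C \<and> weight C = n}"
    then have C: "coded C" by auto
    define O' where "O' = {c \<in> set_mset C. odd c}"
    have finO: "finite O'" by (simp add: O'_def)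
    have inj: "inj_on (\<lambda>c. c div 2) O'"
      by (auto simp: inj_on_def O'_def elim!: oddE)
    have filt: "filter_mset odd C = mset_set O'"
    proof (rule multiset_eqI)
      fix c
      show "count (filter_mset odd C) c = count (mset_set O') c"
      proof (cases "odd c \<and> c \<in># C")
        case True
        then have "count C c = 1"
          using C by (metis One_nat_def coded_def count_greater_zero_iff le_neq_implies_less less_one not_gr_zero)
        then show ?thesis using True finO by (simp add: O'_def)
      next
        case False
        then show ?thesis using finO by (auto simp: O'_def not_in_iff)
      qed
    qed
    have split: "C = filter_mset even C + mset_set O'"
      unfolding filt[symmetric] by (metis multiset_partition)
    have odds: "image_mset (\<lambda>k. 2 * k + 1) (mset_set ((\<lambda>c. c div 2) ` O')) = mset_set O'"
    proof -
      have "image_mset (\<lambda>k. 2 * k + 1) (mset_set ((\<lambda>c. c div 2) ` O'))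
          = image_mset (\<lambda>c. 2 * (c div 2) + 1) (mset_set O')"
        by (simp add: image_mset_mset_set[OF inj, symmetric] multiset.map_comp o_def)
      also have "\<dots> = image_mset (\<lambda>c. c) (mset_set O')"
        using finO by (intro image_mset_cong) (auto simp: O'_def)
      finally show ?thesis by simp
    qed
    have "image_mset (\<lambda>c. c div 2) C - mset_set ((\<lambda>c. c div 2) ` O')
        = image_mset (\<lambda>c. c div 2) (filter_mset even C)"
      by (subst split) (simp add: image_mset_mset_set[OF inj, symmetric])
    then have "image_mset (\<lambda>k. 2 * k) (image_mset (\<lambda>c. c div 2) C - mset_set ((\<lambda>c. c div 2) ` O'))
        = image_mset (\<lambda>c. 2 * (c div 2)) (filter_mset even C)"
      by (simp add: multiset.map_comp o_def)
    also have "\<dots> = image_mset (\<lambda>c. c) (filter_mset even C)"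
      by (intro image_mset_cong) auto
    finally show "encode (decode C) = C"
      using odds split by (simp add: encode_def decode_def O'_def)
  qed
  show "encode ` overpartitions n \<subseteq> {C. coded C \<and> weight C = n}"
  proof clarify
    fix M S assume "(M, S) \<in> overpartitions n"
    then have M: "0 \<notin># M" "sum_mset M = n" "S \<subseteq> set_mset M"
      by (auto simp: overpartitions_def)
    have fin: "finite S" using M(3) finite_subset by blast
    have sub: "mset_set S \<subseteq># M" using mset_set_subseteq M(3) by blast
    have "k \<noteq> 0" if "k \<in># M - mset_set S \<or> k \<in> S" for k
      using that M(1,3) by (metis in_diffD subsetD)
    then have "\<forall>c\<in>#encode (M, S). 2 \<le> c"
      using fin by (force simp: encode_def)
    moreover have "count (encode (M, S)) c \<le> 1" if "odd c" for c
    proof -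
      have "count (image_mset (\<lambda>k. 2 * k) (M - mset_set S)) c = 0"
        using that by (auto simp: not_in_iff[symmetric])
      moreover have "image_mset (\<lambda>k. 2 * k + 1) (mset_set S) = mset_set ((\<lambda>k. 2 * k + 1) ` S)"
        by (intro image_mset_mset_set) (auto simp: inj_on_def)
      ultimately show ?thesis
        by (simp add: encode_def count_mset_set')
    qed
    moreover have "weight (encode (M, S)) = sum_mset (M - mset_set S) + sum_mset (mset_set S)"
      by (simp add: encode_def weight_def multiset.map_comp o_def)
    then have "weight (encode (M, S)) = n"
      using M(2) sub by (metis subset_mset.diff_add sum_mset.union)
    ultimately show "coded (encode (M, S)) \<and> weight (encode (M, S)) = n"
      by (simp add: coded_def)
  qed
  show "decode ` {C. coded C \<and> weight C = n} \<subseteq> overpartitions n"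
    by (fastforce simp: decode_def overpartitions_def coded_def weight_def div_eq_0_iff)
qed

section \<open>Counting overpartitions by their cores\<close>

abbreviation pbar :: "nat \<Rightarrow> nat" where
  "pbar n \<equiv> card (overpartitions n)"

definition num_cores :: "nat \<Rightarrow> nat" where
  "num_cores n = card {C. core C \<and> weight C = n}"

lemma card_coded: "card {C. coded C \<and> weight C = n} = pbar n"
  using bij_betw_encode bij_betw_same_card by metis

lemma finite_coded: "finite {C. coded C \<and> weight C = n}"
  using bij_betw_encode finite_overpartitions bij_betw_finite by metis

lemma finite_core: "finite {C. core C \<and> weight C = n}"
  by (rule finite_subset[OF _ finite_coded[of n]]) (auto simp: core_def)

text \<open>Stripping the plain ones and twos (codes 2 and 4) leaves a core of some weight
  \<open>i\<close>. The missing \<open>n - i\<close> is refilled by choosing the number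
  \<open>j\<close> of twos; ones supply the rest.\<close>

lemma pbar_eq_sum: "pbar n = (\<Sum>i\<le>n. Suc ((n - i) div 2) * num_cores i)"
proof -
  define f where "f = (\<lambda>(i, j, C). C + replicate_mset j 4 + replicate_mset (n - i - 2 * j) (2::nat))"
  define A where "A = (SIGMA i:{..n}. {..(n - i) div 2} \<times> {C. core C \<and> weight C = i})"
  have fm: "filter_mset (\<lambda>c. c \<noteq> 2 \<and> c \<noteq> 4) (f (i, j, C)) = C" "count (f (i, j, C)) 4 = j"
    if "core C" for i j C
  proof -
    have "filter_mset (\<lambda>c. c \<noteq> 2 \<and> c \<noteq> 4) C = C"
      using that unfolding core_def by (subst filter_mset_eq_conv) auto
    moreover have "filter_mset (\<lambda>c. c \<noteq> 2 \<and> c \<noteq> 4) (replicate_mset k (4::nat)) = {#}"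
      "filter_mset (\<lambda>c. c \<noteq> 2 \<and> c \<noteq> 4) (replicate_mset k (2::nat)) = {#}" for k
      by (auto simp: filter_mset_eq_conv)
    ultimately show "filter_mset (\<lambda>c. c \<noteq> 2 \<and> c \<noteq> 4) (f (i, j, C)) = C"
      by (simp add: f_def)
    show "count (f (i, j, C)) 4 = j"
      using that by (simp add: f_def core_def not_in_iff)
  qed
  have "bij_betw f A {C. coded C \<and> weight C = n}"
    unfolding bij_betw_def
  proof
    show "inj_on f A"
    proof (rule inj_onI)
      fix x y assume xy: "x \<in> A" "y \<in> A" "f x = f y"
      obtain i j C where x: "x = (i, j, C)" by (cases x)
      obtain i' j' C' where y: "y = (i', j', C')" by (cases y)
      have "core C" "core C'" "weight C = i" "weight C' = i'" using xy by (auto simp: x y A_def)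
      then show "x = y" using fm xy(3) unfolding x y by metis
    qed
    show "f ` A = {C. coded C \<and> weight C = n}"
    proof
      show "f ` A \<subseteq> {C. coded C \<and> weight C = n}"
        by (auto simp: A_def f_def core_def coded_def split: if_splits)
      show "{C. coded C \<and> weight C = n} \<subseteq> f ` A"
      proof
        fix C assume "C \<in> {C. coded C \<and> weight C = n}"
        then have C: "coded C" "weight C = n" by auto
        define D where "D = filter_mset (\<lambda>c. c \<noteq> 2 \<and> c \<noteq> 4) C"
        have eq: "C = D + replicate_mset (count C 4) 4 + replicate_mset (count C 2) 2"
          by (rule multiset_eqI) (auto simp: D_def)
        have w: "weight D + 2 * count C 4 + count C 2 = n"
          using C(2) arg_cong[OF eq, of weight] by simp
        have "core D" using C(1) by (auto simp: D_def core_def coded_def)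
        then have "(weight D, count C 4, D) \<in> A" using w by (auto simp: A_def)
        moreover have "f (weight D, count C 4, D) = C"
        proof -
          have "n - weight D - 2 * count C 4 = count C 2" using w by simp
          then show ?thesis using eq by (simp add: f_def)
        qed
        ultimately show "C \<in> f ` A" by (metis image_eqI)
      qed
    qed
  qed
  then have "pbar n = card A"
    using bij_betw_same_card card_coded by metis
  also have "\<dots> = (\<Sum>i\<le>n. Suc ((n - i) div 2) * num_cores i)"
    unfolding A_def by (subst card_SigmaI) (auto simp: finite_core card_cartesian_product num_cores_def)
  finally show ?thesis .
qed

lemma pbar_mono:
  assumes "m \<le> n" shows "pbar m \<le> pbar n"
proof -
  have "pbar m \<le> (\<Sum>i\<le>m. Suc ((n - i) div 2) * num_cores i)"
    unfolding pbar_eq_sum using assms by (intro sum_mono mult_right_mono Suc_leI)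
      (auto intro!: div_le_mono simp: less_Suc_eq_le)
  also have "\<dots> \<le> pbar n"
    unfolding pbar_eq_sum using assms by (intro sum_mono2) auto
  finally show ?thesis .
qed

lemma sum_num_cores_le_pbar: "(\<Sum>i\<le>n. num_cores i) \<le> pbar n"
  unfolding pbar_eq_sum by (intro sum_mono) simp

section \<open>Cutting a core at a prescribed weight\<close>

lemma core_mono: "core B \<Longrightarrow> A \<subseteq># B \<Longrightarrow> core A"
  unfolding core_def coded_def by (meson mset_subset_eqD mset_subset_eq_count order_trans)

text \<open>The codes are scanned in descending order: the largest one either straddles the cut
  itself, or goes to \<open>A\<close> and lowers the remaining target by its weight.\<close>

lemma crossing:
  assumes "m < weight C"
  shows "\<exists>A z B. C = add_mset z (A + B) \<and> (\<forall>a\<in>#A. z \<le> a) \<and> (\<forall>b\<in>#B. b \<le> z) \<and>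
           weight A \<le> m \<and> m < weight A + z div 2"
  using assms
proof (induction C arbitrary: m rule: multiset_induct_max)
  case empty
  then show ?case by simp
next
  case (add x C)
  show ?case
  proof (cases "m < x div 2")
    case True
    then show ?thesis using add.hyps
      by (intro exI[of _ "{#}"] exI[of _ x] exI[of _ C]) auto
  next
    case False
    then have "m - x div 2 < weight C" using add.prems by simp
    then obtain A z B where *: "C = add_mset z (A + B)" "\<forall>a\<in>#A. z \<le> a" "\<forall>b\<in>#B. b \<le> z"
      "weight A \<le> m - x div 2" "m - x div 2 < weight A + z div 2"
      using add.IH by blast
    then show ?thesis using False add.hyps
      by (intro exI[of _ "add_mset x A"] exI[of _ z] exI[of _ B]) auto
  qed
qed

text \<open>Pieces of a split part enter as plain parts: even codes may repeat, and from size 3 on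
  they stay clear of the filler.\<close>

lemma core_add_even: "core A \<Longrightarrow> 3 \<le> u \<Longrightarrow> core (add_mset (2 * u) A)"
  by (auto simp: core_def coded_def)

lemma Min_add_mset:
  fixes x :: nat
  shows "\<forall>a\<in>#A. x \<le> a \<Longrightarrow> Min_mset (add_mset x A) = x"
  by (intro Min_eqI) auto

text \<open>The additive form of the bound leaves the set empty when \<open>n < d\<close>, where
  truncated subtraction would not.\<close>

lemma core_le_eq_UN: "{C. core C \<and> weight C + d \<le> n} = (\<Union>k\<in>{k. k + d \<le> n}. {C. core C \<and> weight C = k})"
  by auto

lemma finite_add_le: "finite {k::nat. k + d \<le> n}"
  by (rule finite_subset[of _ "{..n}"]) auto

lemma finite_core_le: "finite {C. core C \<and> weight C + d \<le> n}"
  unfolding core_le_eq_UN by (intro finite_UN_I finite_core finite_add_le)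

lemma card_core_le: "card {C. core C \<and> weight C + d \<le> n} \<le> (\<Sum>k | k + d \<le> n. num_cores k)"
  unfolding core_le_eq_UN num_cores_def by (rule card_UN_le[OF finite_add_le])

text \<open>This is \<open>num_cores (m - f)\<close>, except that it vanishes for
  \<open>f > m\<close>. It serves the left shares \<open>f = 0, 1, 2\<close>, which cannot be stored
  as a plain part of a core.\<close>

definition num_cores_shift :: "nat \<Rightarrow> nat \<Rightarrow> nat" where
  "num_cores_shift f m = card {C. core C \<and> weight C + f = m}"

lemma finite_core_shift: "finite {C. core C \<and> weight C + f = m}"
  by (rule finite_subset[OF _ finite_core[of "m - f"]]) auto

text \<open>
  Here \<open>u = m - weight A\<close> units of \<open>z\<close> go to the left, where \<open>u\<close> is recognised as the smallest
  part (or is one of 0, 1, 2), and the other \<open>v \<ge> d\<close> units are dropped on the right, where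
  \<open>v\<close> is read off from the weight deficit. The last bit is the overline of \<open>z\<close>.
\<close>

lemma card_split_right:
  assumes "d \<ge> 1"
  shows "card {C. core C \<and> weight C = m + n \<and>
           (\<exists>A z B. C = add_mset z (A + B) \<and> (\<forall>a\<in>#A. z \<le> a) \<and>
           weight A \<le> m \<and> m + d \<le> weight A + z div 2)}
         \<le> 2 * (num_cores m + (\<Sum>f\<le>2. num_cores_shift f m)) * (\<Sum>k | k + d \<le> n. num_cores k)" (is "card ?I \<le> _")
proof -
  define L where "L = {C. core C \<and> weight C + d \<le> n}"
  \<comment> \<open>The maps \<open>D1\<close> and \<open>D0\<close> are decoders for the cases
    \<open>u \<ge> 3\<close> and \<open>u = f \<le> 2\<close>; covering the set by their images
    bounds its size.\<close>
  define D1 where "D1 = (\<lambda>b (\<mu>, \<nu>). add_mset (2 * (Min_mset \<mu> div 2 + (n - weight \<nu>)) + b)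
    ((\<mu> - {#Min_mset \<mu>#}) + \<nu>))"
  define D0 where "D0 = (\<lambda>b f (\<mu>, \<nu>). add_mset (2 * (f + (n - weight \<nu>)) + b) (\<mu> + \<nu>))"
  define X where "X = {C. core C \<and> weight C = m} \<times> L"
  define Y where "Y = (\<lambda>f. {C. core C \<and> weight C + f = m} \<times> L)"
  have fin: "finite X" "finite (Y f)" for f
    by (auto simp: X_def Y_def L_def finite_core finite_core_shift finite_core_le)
  have sub: "?I \<subseteq> (\<Union>b<2. D1 b ` X \<union> (\<Union>f\<le>2. D0 b f ` Y f))"
  proof
    fix C assume "C \<in> ?I"
    then obtain A z B where C: "core C" "weight C = m + n" "C = add_mset z (A + B)"
      "\<forall>a\<in>#A. z \<le> a" "weight A \<le> m" "m + d \<le> weight A + z div 2" by blast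
    have cA: "core A" and cB: "core B"
      using C(1) unfolding C(3) by (auto elim!: core_mono simp: subset_mset.add_increasing)
    define u v where "u = m - weight A" and "v = weight A + z div 2 - m"
    have uv: "weight A + u = m" "weight B + v = n" "z div 2 = u + v" "v \<ge> d"
      using C by (auto simp: u_def v_def)
    have z: "z = 2 * (u + v) + z mod 2" using uv(3) by presburger
    have nB: "n - weight B = v" and BL: "B \<in> L" using uv cB by (auto simp: L_def)
    have b: "z mod 2 \<in> {..<2}" by simp
    show "C \<in> (\<Union>b<2. D1 b ` X \<union> (\<Union>f\<le>2. D0 b f ` Y f))"
    proof (cases "u \<ge> 3")
      case True
      \<comment> \<open>Every \<open>a\<close> in \<open>A\<close> satisfies
        \<open>2 * u \<le> z \<le> a\<close>, so the new part is the smallest.\<close>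
      have Min: "Min_mset (add_mset (2 * u) A) = 2 * u"
        using C(4) z by (intro Min_add_mset) force
      have "D1 (z mod 2) (add_mset (2 * u) A, B) = C"
        unfolding D1_def prod.case Min nB using z C(3) by simp
      moreover have "(add_mset (2 * u) A, B) \<in> X"
        using core_add_even[OF cA True] uv BL by (simp add: X_def)
      ultimately show ?thesis using b by blast
    next
      case False
      then have "u \<in> {..2}" by simp
      moreover have "D0 (z mod 2) u (A, B) = C"
        unfolding D0_def prod.case nB using z C(3) by simp
      moreover have "(A, B) \<in> Y u"
        using cA uv BL by (simp add: Y_def)
      ultimately show ?thesis using b by blast
    qed
  qed
  have "card ?I \<le> card (\<Union>b<2. D1 b ` X \<union> (\<Union>f\<le>2. D0 b f ` Y f))"
    using sub fin by (intro card_mono) auto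
  also have "\<dots> \<le> (\<Sum>b<(2::nat). card (D1 b ` X \<union> (\<Union>f\<le>2. D0 b f ` Y f)))"
    by (intro card_UN_le) auto
  also have "\<dots> \<le> (\<Sum>b<(2::nat). card X + (\<Sum>f\<le>2. card (Y f)))"
    by (intro sum_mono order_trans[OF card_Un_le] add_mono card_image_le fin
        order_trans[OF card_UN_le]) auto
  also have "\<dots> = 2 * (num_cores m + (\<Sum>f\<le>2. num_cores_shift f m)) * card L"
    by (simp add: X_def Y_def card_cartesian_product num_cores_def
      num_cores_shift_def algebra_simps sum_distrib_left sum_distrib_right)
  also have "\<dots> \<le> 2 * (num_cores m + (\<Sum>f\<le>2. num_cores_shift f m)) * (\<Sum>k | k + d \<le> n. num_cores k)"
    unfolding L_def by (intro mult_left_mono card_core_le) auto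
  finally show ?thesis .
qed

text \<open>
  If \<open>u\<close> is large, breaking it into \<open>j\<close> and \<open>u - j\<close>, the two smallest parts on the left, gives
  \<open>T\<close> different images.
\<close>

lemma card_split_left:
  "T * card {C. core C \<and> weight C = m + n \<and>
           (\<exists>A z B. C = add_mset z (A + B) \<and> (\<forall>a\<in>#A. z \<le> a) \<and>
           weight A + (2 * T + 4) \<le> m \<and> m < weight A + z div 2)}
         \<le> 2 * num_cores m * (\<Sum>k\<le>n. num_cores k)" (is "T * card ?I \<le> _")
proof -
  define L where "L = {C. core C \<and> weight C + 0 \<le> n}"
  define D where "D = (\<lambda>b (\<mu>, \<nu>). let j = Min_mset \<mu>; \<mu>' = \<mu> - {#j#}; x = Min_mset \<mu>' in
    (add_mset (2 * (j div 2 + x div 2 + (n - weight \<nu>)) + b) ((\<mu>' - {#x#}) + \<nu>), j div 2))"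
  define X where "X = {C. core C \<and> weight C = m} \<times> L"
  have fin: "finite X"
    unfolding X_def L_def by (intro finite_cartesian_product finite_core finite_core_le)
  have sub: "?I \<times> {3..<T+3} \<subseteq> (\<Union>b<2. D b ` X)"
  proof clarify
    fix A B :: "nat multiset" and z j
    define C where "C = add_mset z (A + B)"
    assume "core (add_mset z (A + B))" "weight (add_mset z (A + B)) = m + n"
      and C': "\<forall>a\<in>#A. z \<le> a" "weight A + (2 * T + 4) \<le> m" "m < weight A + z div 2"
      and j: "j \<in> {3..<T+3}"
    then have C: "core C" "weight C = m + n" "C = add_mset z (A + B)" by (simp_all add: C_def)
    have cA: "core A" and cB: "core B"
      using C(1) unfolding C(3) by (auto elim!: core_mono simp: subset_mset.add_increasing)
    define u v where "u = m - weight A" and "v = weight A + z div 2 - m"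
    have uv: "weight A + u = m" "weight B + v = n" "z div 2 = u + v" "u \<ge> 2 * T + 4"
      using C C' by (auto simp: u_def v_def)
    have z: "z = 2 * (u + v) + z mod 2" using uv(3) by presburger
    have nB: "n - weight B = v" and BL: "B \<in> L" using uv cB by (auto simp: L_def)
    have b: "z mod 2 \<in> {..<2}" by simp
    \<comment> \<open>From \<open>j \<le> T + 2\<close> and \<open>u \<ge> 2 * T + 4\<close> follows
      \<open>u - j \<ge> T + 2 \<ge> j\<close>: both pieces are admissible in a core, and their
      order is known.\<close>
    have ju: "3 \<le> j" "3 \<le> u - j" "j \<le> u - j" "j + (u - j) = u" using j uv(4) by auto
    define \<mu>' where "\<mu>' = add_mset (2 * (u - j)) A"
    have Min': "Min_mset \<mu>' = 2 * (u - j)"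
      unfolding \<mu>'_def using C' z by (intro Min_add_mset) force
    have Min: "Min_mset (add_mset (2 * j) \<mu>') = 2 * j"
      unfolding \<mu>'_def using C' z ju by (intro Min_add_mset) force
    have "D (z mod 2) (add_mset (2 * j) \<mu>', B) = (C, j)"
      unfolding D_def prod.case Min nB Let_def add_mset_remove_trivial Min'
      using z C(3) ju by (simp add: \<mu>'_def)
    moreover have "(add_mset (2 * j) \<mu>', B) \<in> X"
      unfolding \<mu>'_def using core_add_even[OF core_add_even[OF cA]] uv BL ju by (simp add: X_def)
    ultimately show "(add_mset z (A + B), j) \<in> (\<Union>b<2. D b ` X)"
      unfolding C_def[symmetric] using b by (metis UN_I image_eqI)
  qed
  have "T * card ?I = card (?I \<times> {3..<T+3})"
    by (simp add: card_cartesian_product)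
  also have "\<dots> \<le> card (\<Union>b<2. D b ` X)"
    using sub fin by (intro card_mono) auto
  also have "\<dots> \<le> (\<Sum>b<(2::nat). card (D b ` X))"
    by (intro card_UN_le) auto
  also have "\<dots> \<le> (\<Sum>b<(2::nat). card X)"
    by (intro sum_mono card_image_le fin)
  also have "\<dots> = 2 * num_cores m * card L"
    by (simp add: X_def card_cartesian_product num_cores_def)
  also have "\<dots> \<le> 2 * num_cores m * (\<Sum>k\<le>n. num_cores k)"
    unfolding L_def using card_core_le[of 0 n] by (intro mult_left_mono) (auto simp: atMost_def)
  finally show ?thesis .
qed

lemma size_le_weight: "coded C \<Longrightarrow> size C \<le> weight C"
proof -
  assume "coded C"
  then have "\<forall>c\<in>#C. 2 \<le> c" by (simp add: coded_def)
  then show ?thesis by (induction C) auto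
qed

text \<open>Such a core is determined by \<open>q\<close> multiplicities, each at most its size and
  hence at most its weight.\<close>

lemma card_core_bounded: "card {X. core X \<and> weight X \<le> k \<and> (\<forall>c\<in>#X. c < q)} \<le> (k + 1) ^ q"
  and finite_core_bounded: "finite {X. core X \<and> weight X \<le> k \<and> (\<forall>c\<in>#X. c < q)}"
proof -
  let ?S = "{X. core X \<and> weight X \<le> k \<and> (\<forall>c\<in>#X. c < q)}"
  let ?F = "{..<q} \<rightarrow>\<^sub>E {..k}"
  define r where "r = (\<lambda>X. restrict (count X) {..<q})"
  have "inj_on r ?S"
  proof (rule inj_onI)
    fix X Y assume XY: "X \<in> ?S" "Y \<in> ?S" "r X = r Y"
    show "X = Y"
    proof (rule multiset_eqI)
      fix c
      show "count X c = count Y c"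
      proof (cases "c < q")
        case True
        then show ?thesis using fun_cong[OF XY(3), of c] by (simp add: r_def)
      next
        case False
        then have "c \<notin># X" "c \<notin># Y" using XY by auto
        then show ?thesis by (simp add: not_in_iff)
      qed
    qed
  qed
  moreover have "r ` ?S \<subseteq> ?F"
  proof clarify
    fix X assume "core X" "weight X \<le> k"
    then have "count X c \<le> k" for c
      using count_le_size[of X c] size_le_weight[of X] by (auto simp: core_def)
    then show "r X \<in> ?F" by (auto simp: r_def)
  qed
  moreover have F: "finite ?F" by (intro finite_PiE) auto
  ultimately show "finite ?S" "card ?S \<le> (k + 1) ^ q"
    using card_inj_on_le[of r ?S ?F] inj_on_finite[of r ?S ?F] by (auto simp: card_funcsetE)
qed

text \<open>All codes from the cut on are at most \<open>z < q\<close>, so \<open>z\<close> joined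
  to \<open>B\<close> is one of polynomially many bounded cores.\<close>

lemma card_split_small:
  "card {C. core C \<and> weight C = m + n \<and>
           (\<exists>A z B. C = add_mset z (A + B) \<and> (\<forall>b\<in>#B. b \<le> z) \<and>
           weight A \<le> m \<and> z < q)}
         \<le> (\<Sum>k\<le>m. num_cores k) * (m + n + 1) ^ q" (is "card ?I \<le> _")
proof -
  define L where "L = {C. core C \<and> weight C + 0 \<le> m}"
  define S where "S = {X. core X \<and> weight X \<le> m + n \<and> (\<forall>c\<in>#X. c < q)}"
  have fin: "finite (L \<times> S)"
    unfolding L_def S_def by (intro finite_cartesian_product finite_core_le finite_core_bounded)
  have "?I \<subseteq> (\<lambda>(A, X). A + X) ` (L \<times> S)"
  proof clarify
    fix A B :: "nat multiset" and z
    assume C: "core (add_mset z (A + B))" "weight (add_mset z (A + B)) = m + n"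
      "\<forall>b\<in>#B. b \<le> z" "weight A \<le> m" "z < q"
    have "core (A + add_mset z B)" using C(1) by simp
    then have "core A" "core (add_mset z B)"
      by (auto elim!: core_mono simp del: union_mset_add_mset_right)
    then have "(A, add_mset z B) \<in> L \<times> S"
      using C by (auto simp: L_def S_def)
    then show "add_mset z (A + B) \<in> (\<lambda>(A, X). A + X) ` (L \<times> S)"
      by (intro image_eqI[of _ _ "(A, add_mset z B)"]) auto
  qed
  then have "card ?I \<le> card (L \<times> S)"
    using fin by (meson card_image_le card_mono finite_imageI order_trans)
  also have "\<dots> = card L * card S" by (simp add: card_cartesian_product)
  also have "\<dots> \<le> (\<Sum>k\<le>m. num_cores k) * (m + n + 1) ^ q"
    unfolding L_def S_def using card_core_le[of 0 m]
    by (intro mult_mono card_core_bounded) (auto simp: atMost_def)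
  finally show ?thesis .
qed

text \<open>The three summands belong to a large right share \<open>v \<ge> 2 * T\<close>, a large
  left share \<open>u \<ge> 2 * T + 4\<close>, and both small. The second gains its factor
  \<open>T\<close> here; in the first, \<open>T\<close> stays with the tail sum, to be absorbed by
  filler later.\<close>

lemma num_cores_add_le:
  assumes "T \<ge> 1" "n \<ge> 1"
  shows "T * num_cores (m + n) \<le> 2 * (num_cores m + (\<Sum>f\<le>2. num_cores_shift f m))
      * (T * (\<Sum>k | k + 2 * T \<le> n. num_cores k))
     + 2 * num_cores m * (\<Sum>k\<le>n. num_cores k) + T * ((\<Sum>k\<le>m. num_cores k) * (m + n + 1) ^ (8 * T + 8))"
proof -
  define S1 where "S1 = {C. core C \<and> weight C = m + n \<and>
           (\<exists>A z B. C = add_mset z (A + B) \<and> (\<forall>a\<in>#A. z \<le> a) \<and>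
           weight A \<le> m \<and> m + 2 * T \<le> weight A + z div 2)}"
  define S2 where "S2 = {C. core C \<and> weight C = m + n \<and>
           (\<exists>A z B. C = add_mset z (A + B) \<and> (\<forall>a\<in>#A. z \<le> a) \<and>
           weight A + (2 * T + 4) \<le> m \<and> m < weight A + z div 2)}"
  define S3 where "S3 = {C. core C \<and> weight C = m + n \<and>
           (\<exists>A z B. C = add_mset z (A + B) \<and> (\<forall>b\<in>#B. b \<le> z) \<and>
           weight A \<le> m \<and> z < 8 * T + 8)}"
  have "{C. core C \<and> weight C = m + n} \<subseteq> S1 \<union> S2 \<union> S3"
  proof
    fix C assume "C \<in> {C. core C \<and> weight C = m + n}"
    then have C: "core C" "weight C = m + n" by auto
    then obtain A z B where *: "C = add_mset z (A + B)" "\<forall>a\<in>#A. z \<le> a" "\<forall>b\<in>#B. b \<le> z"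
      "weight A \<le> m" "m < weight A + z div 2"
      using crossing[of m C] assms by auto
    \<comment> \<open>If the first two cases fail, then \<open>z div 2 = u + v < 4 * T + 4\<close>,
      which gives the bound on \<open>z\<close>.\<close>
    consider "m + 2 * T \<le> weight A + z div 2" | "weight A + (2 * T + 4) \<le> m" | "z < 8 * T + 8"
      by linarith
    then show "C \<in> S1 \<union> S2 \<union> S3"
    proof cases
      case 1 then have "C \<in> S1" unfolding S1_def using C * by blast
      then show ?thesis by simp
    next
      case 2 then have "C \<in> S2" unfolding S2_def using C * by blast
      then show ?thesis by simp
    next
      case 3 then have "C \<in> S3" unfolding S3_def using C * by blast
      then show ?thesis by simp
    qed
  qed
  moreover have "finite (S1 \<union> S2 \<union> S3)"
    by (rule finite_subset[OF _ finite_core[of "m + n"]]) (auto simp: S1_def S2_def S3_def)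
  ultimately have "num_cores (m + n) \<le> card (S1 \<union> S2 \<union> S3)"
    unfolding num_cores_def by (rule card_mono[rotated])
  also have "\<dots> \<le> card S1 + card S2 + card S3"
    by (meson add_mono card_Un_le le_refl order_trans)
  finally have "T * num_cores (m + n) \<le> T * card S1 + T * card S2 + T * card S3"
    by (metis distrib_left mult_le_mono2)
  also have "\<dots> \<le> T * (2 * (num_cores m + (\<Sum>f\<le>2. num_cores_shift f m)) * (\<Sum>k | k + 2 * T \<le> n. num_cores k))
     + 2 * num_cores m * (\<Sum>k\<le>n. num_cores k) + T * ((\<Sum>k\<le>m. num_cores k) * (m + n + 1) ^ (8 * T + 8))"
    unfolding S1_def S2_def S3_def using assms
    by (intro add_mono mult_left_mono card_split_left card_split_right card_split_small) auto
  finally show ?thesis by (simp add: ac_simps)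
qed

section \<open>From cores back to overpartitions\<close>

text \<open>Removing any one part leaves a core of weight at most \<open>n\<close>; the missing
  weight and one overline bit restore the part.\<close>

lemma num_cores_Suc_le: "num_cores (Suc n) \<le> 2 * pbar n"
proof -
  define L where "L = {C. core C \<and> weight C + 0 \<le> n}"
  have "{C. core C \<and> weight C = Suc n} \<subseteq> (\<Union>b<2. (\<lambda>B. add_mset (2 * (Suc n - weight B) + b) B) ` L)"
  proof clarify
    fix C assume C: "core C" "weight C = Suc n"
    then obtain z B where CB: "C = add_mset z B" by (metis Zero_not_Suc multiset_cases weight_simps(1))
    have "core B" using C by (auto simp: CB elim!: core_mono)
    have "z \<ge> 2" using C by (auto simp: CB core_def coded_def)
    then have "weight B + z div 2 = Suc n" "z div 2 \<ge> 1" using C by (auto simp: CB)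
    then have "2 * (Suc n - weight B) + z mod 2 = z" "B \<in> L" using \<open>core B\<close>
      unfolding L_def by (presburger, auto)
    then show "C \<in> (\<Union>b<2. (\<lambda>B. add_mset (2 * (Suc n - weight B) + b) B) ` L)"
      by (intro UN_I[of "z mod 2"] image_eqI[of _ _ B]) (auto simp: CB)
  qed
  moreover have fin: "finite L" unfolding L_def by (rule finite_core_le)
  ultimately have "num_cores (Suc n) \<le> card (\<Union>b<2. (\<lambda>B. add_mset (2 * (Suc n - weight B) + b) B) ` L)"
    unfolding num_cores_def by (intro card_mono) auto
  also have "\<dots> \<le> (\<Sum>b<(2::nat). card L)"
    by (intro order_trans[OF card_UN_le] sum_mono card_image_le fin) auto
  also have "\<dots> \<le> 2 * pbar n"
    using card_core_le[of 0 n] sum_num_cores_le_pbar[of n] by (auto simp: L_def atMost_def)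
  finally show ?thesis .
qed

text \<open>After reindexing by the core weight, the shift by \<open>f\<close> only shortens the
  filler, which lowers each coefficient.\<close>

lemma sum_num_cores_shift_le: "(\<Sum>m\<le>n. Suc ((n - m) div 2) * num_cores_shift f m) \<le> pbar n"
proof -
  have num_cores_shift: "num_cores_shift f m = (if f \<le> m then num_cores (m - f) else 0)" for m
  proof (cases "f \<le> m")
    case True
    then have "{C. core C \<and> weight C + f = m} = {C. core C \<and> weight C = m - f}" by auto
    then show ?thesis using True by (simp add: num_cores_shift_def num_cores_def)
  next
    case False
    then have "{C. core C \<and> weight C + f = m} = {}" by auto
    then show ?thesis using False by (simp add: num_cores_shift_def)
  qed
  have "(\<Sum>m\<le>n. Suc ((n - m) div 2) * num_cores_shift f m)
      = (\<Sum>m\<in>{f..n}. Suc ((n - m) div 2) * num_cores_shift f m)"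
    by (intro sum.mono_neutral_right) (auto simp: num_cores_shift)
  also have "\<dots> = (\<Sum>i\<in>{i. i + f \<le> n}. Suc ((n - (i + f)) div 2) * num_cores i)"
    by (rule sum.reindex_bij_witness[of _ "\<lambda>i. i + f" "\<lambda>m. m - f"]) (auto simp: num_cores_shift)
  also have "\<dots> \<le> (\<Sum>i\<in>{i. i + f \<le> n}. Suc ((n - i) div 2) * num_cores i)"
    by (intro sum_mono mult_right_mono) (auto intro!: div_le_mono)
  also have "\<dots> \<le> pbar n"
    unfolding pbar_eq_sum by (intro sum_mono2) auto
  finally show ?thesis .
qed

text \<open>The sum over core weights is divided at \<open>n2\<close>. Cores of weight
  \<open>m + n2\<close> are cut at \<open>m\<close>; the lighter ones form the last error
  term.\<close>

lemma pbar_add_le: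
  assumes "T \<ge> 1" "n2 \<ge> 1"
  shows "T * pbar (n1 + n2) \<le> 10 * (pbar n1 * pbar n2)
     + T * ((n1 + 1)\<^sup>2 * (n1 + n2 + 1) ^ (8 * T + 8)) * pbar n1 + T * (2 * (n1 + 1)) * pbar n2"
proof -
  define q where "q = (n1 + n2 + 1) ^ (8 * T + 8)"
  define h where "h = (\<lambda>k::nat. Suc (k div 2))"
  have h_le: "h k \<le> n1 + 1" if "k \<le> n1" for k using that by (simp add: h_def)
  have pbar_eq: "pbar n = (\<Sum>i\<le>n. h (n - i) * num_cores i)" for n unfolding h_def by (rule pbar_eq_sum)
  \<comment> \<open>A deficit of at least \<open>2 * T\<close> leaves more than \<open>T\<close>
    arrangements of filler, hence the threshold \<open>2 * T\<close> for a large right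
    share.\<close>
  have tail: "T * (\<Sum>k | k + 2 * T \<le> n2. num_cores k) \<le> pbar n2"
  proof -
    have "T * (\<Sum>k | k + 2 * T \<le> n2. num_cores k) \<le> (\<Sum>k | k + 2 * T \<le> n2. h (n2 - k) * num_cores k)"
      unfolding sum_distrib_left
    proof (intro sum_mono mult_right_mono)
      fix k assume "k \<in> {k. k + 2 * T \<le> n2}"
      then have "T \<le> (n2 - k) div 2" by auto
      then show "T \<le> h (n2 - k)" by (simp add: h_def)
    qed auto
    also have "\<dots> \<le> pbar n2"
      unfolding pbar_eq by (intro sum_mono2) auto
    finally show ?thesis .
  qed
  have core_bound: "T * num_cores (m + n2) \<le> 2 * (num_cores m + (\<Sum>f\<le>2. num_cores_shift f m))
      * pbar n2 + 2 * num_cores m * pbar n2 + T * (pbar n1 * q)"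
    if "m \<le> n1" for m
  proof -
    have "(\<Sum>k\<le>m. num_cores k) * (m + n2 + 1) ^ (8 * T + 8) \<le> pbar n1 * q"
      unfolding q_def using that sum_num_cores_le_pbar[of m] pbar_mono[OF that]
      by (intro mult_mono power_mono) auto
    then show ?thesis
      using num_cores_add_le[OF assms, of m] tail sum_num_cores_le_pbar[of n2]
      by (elim order_trans) (intro add_mono mult_left_mono, auto)
  qed
  have split: "pbar (n1 + n2) = (\<Sum>i<n2. h (n1 + n2 - i) * num_cores i)
      + (\<Sum>m\<le>n1. h (n1 - m) * num_cores (m + n2))"
  proof -
    have "{..n1 + n2} = {..<n2} \<union> {n2..n1 + n2}" by auto
    then have "pbar (n1 + n2) = (\<Sum>i<n2. h (n1 + n2 - i) * num_cores i)
        + (\<Sum>i\<in>{n2..n1 + n2}. h (n1 + n2 - i) * num_cores i)"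
      unfolding pbar_eq by (simp only:) (rule sum.union_disjoint, auto)
    also have "(\<Sum>i\<in>{n2..n1 + n2}. h (n1 + n2 - i) * num_cores i) = (\<Sum>m\<le>n1. h (n1 - m) * num_cores (m + n2))"
      by (rule sum.reindex_bij_witness[of _ "\<lambda>m. m + n2" "\<lambda>i. i - n2"]) auto
    finally show ?thesis .
  qed
  \<comment> \<open>For a fixed lighter core, \<open>n1\<close> further units of filler multiply the
    number of arrangements by at most \<open>2 * (n1 + 1)\<close>.\<close>
  have first: "(\<Sum>i<n2. h (n1 + n2 - i) * num_cores i) \<le> 2 * (n1 + 1) * pbar n2"
  proof -
    have "h (n1 + n2 - i) \<le> 2 * (n1 + 1) * h (n2 - i)" if "i < n2" for i
    proof -
      have "h (n1 + n2 - i) \<le> n1 + 1 + h (n2 - i)" using that unfolding h_def by simp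
      also have "\<dots> \<le> (n1 + 1) * h (n2 - i) + (n1 + 1) * h (n2 - i)"
        unfolding h_def by (intro add_mono) simp_all
      finally show ?thesis by simp
    qed
    then have "(\<Sum>i<n2. h (n1 + n2 - i) * num_cores i)
        \<le> (\<Sum>i<n2. 2 * (n1 + 1) * (h (n2 - i) * num_cores i))"
      by (intro sum_mono) (metis lessThan_iff mult.assoc mult_le_mono1)
    also have "\<dots> = 2 * (n1 + 1) * (\<Sum>i<n2. h (n2 - i) * num_cores i)"
      by (simp only: sum_distrib_left)
    also have "\<dots> \<le> 2 * (n1 + 1) * pbar n2"
      unfolding pbar_eq by (intro mult_left_mono sum_mono2) auto
    finally show ?thesis .
  qed
  \<comment> \<open>The 10 is 2 + 2 from the two splittings with \<open>num_cores m\<close>, plus 2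
    for each of the three shifts.\<close>
  have second: "T * (\<Sum>m\<le>n1. h (n1 - m) * num_cores (m + n2))
      \<le> 10 * (pbar n1 * pbar n2) + T * ((n1 + 1)\<^sup>2 * q) * pbar n1"
  proof -
    have "T * (\<Sum>m\<le>n1. h (n1 - m) * num_cores (m + n2)) = (\<Sum>m\<le>n1. h (n1 - m) * (T * num_cores (m + n2)))"
      by (simp add: sum_distrib_left ac_simps)
    also have "\<dots> \<le> (\<Sum>m\<le>n1. h (n1 - m) *
        (2 * (num_cores m + (\<Sum>f\<le>2. num_cores_shift f m)) * pbar n2 + 2 * num_cores m * pbar n2 + T * (pbar n1 * q)))"
      using core_bound by (intro sum_mono mult_left_mono) auto
    also have "\<dots> = 4 * pbar n2 * (\<Sum>m\<le>n1. h (n1 - m) * num_cores m)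
        + 2 * pbar n2 * (\<Sum>m\<le>n1. h (n1 - m) * (\<Sum>f\<le>2. num_cores_shift f m))
        + (\<Sum>m\<le>n1. h (n1 - m)) * (T * (pbar n1 * q))"
      by (simp add: algebra_simps sum.distrib sum_distrib_left sum_distrib_right)
    also have "(\<Sum>m\<le>n1. h (n1 - m) * (\<Sum>f\<le>2. num_cores_shift f m))
        = (\<Sum>f\<le>2. \<Sum>m\<le>n1. h (n1 - m) * num_cores_shift f m)"
      unfolding sum_distrib_left by (rule sum.swap)
    also have "4 * pbar n2 * (\<Sum>m\<le>n1. h (n1 - m) * num_cores m)
        + 2 * pbar n2 * (\<Sum>f\<le>2. \<Sum>m\<le>n1. h (n1 - m) * num_cores_shift f m)
        + (\<Sum>m\<le>n1. h (n1 - m)) * (T * (pbar n1 * q))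
      \<le> 4 * pbar n2 * pbar n1 + 2 * pbar n2 * (\<Sum>f\<le>(2::nat). pbar n1)
        + (\<Sum>m\<le>n1. n1 + 1) * (T * (pbar n1 * q))"
      unfolding pbar_eq[of n1, symmetric]
      by (intro add_mono mult_left_mono mult_right_mono sum_mono h_le)
        (use sum_num_cores_shift_le in \<open>auto simp: h_def\<close>)
    also have "\<dots> = 10 * (pbar n1 * pbar n2) + T * ((n1 + 1)\<^sup>2 * q) * pbar n1"
      by (simp add: algebra_simps power2_eq_square)
    finally show ?thesis .
  qed
  have "T * (\<Sum>i<n2. h (n1 + n2 - i) * num_cores i) \<le> T * (2 * (n1 + 1)) * pbar n2"
    using mult_le_mono2[OF first, of T] by (simp only: mult.assoc)
  then show ?thesis
    using second unfolding split q_def[symmetric] by (simp add: distrib_left)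
qed

section \<open>Growth of the number of overpartitions\<close>

text \<open>Any subset of \<open>{1..k}\<close> can serve as the set of overlined parts: its sum is
  at most \<open>k\<^sup>2\<close>, and plain ones fill up the rest.\<close>

lemma power_two_le_pbar:
  assumes "k\<^sup>2 \<le> n" shows "2 ^ k \<le> pbar n"
proof -
  define f :: "nat set \<Rightarrow> overpartition" where
    "f = (\<lambda>S. (mset_set S + replicate_mset (n - \<Sum>S) 1, S))"
  have "f S \<in> overpartitions n" if S: "S \<subseteq> {1..k}" for S
  proof -
    have fin: "finite S" using S finite_subset by blast
    have "\<Sum>S \<le> \<Sum>{1..k}" using S by (intro sum_mono2) auto
    also have "\<dots> \<le> (\<Sum>i\<in>{1..k}. k)" by (intro sum_mono) auto
    also have "\<dots> \<le> n" using assms by (simp add: power2_eq_square)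
    finally have "\<Sum>S \<le> n" .
    then show ?thesis using S fin
      by (auto simp: f_def overpartitions_def sum_unfold_sum_mset split: if_splits)
  qed
  moreover have "inj_on f (Pow {1..k})" by (auto simp: f_def inj_on_def)
  ultimately have "card (Pow {1..k}) \<le> pbar n"
    by (intro card_inj_on_le[of f] finite_overpartitions) auto
  then show ?thesis by (simp add: card_Pow)
qed

lemma ex_nat_sqrt: "\<exists>k::nat. k\<^sup>2 \<le> n \<and> n < (k + 1)\<^sup>2"
proof (induction n)
  case 0
  show ?case by (intro exI[of _ 0]) auto
next
  case (Suc n)
  then obtain k where k: "k\<^sup>2 \<le> n" "n < (k + 1)\<^sup>2" by blast
  show ?case
  proof (cases "Suc n < (k + 1)\<^sup>2")
    case True then show ?thesis using k by (intro exI[of _ k]) auto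
  next
    case False
    then have "Suc n = (k + 1)\<^sup>2" using k by simp
    then show ?thesis by (intro exI[of _ "k + 1"]) (auto simp: power2_eq_square)
  qed
qed

lemma pbar_superpolynomial: "\<exists>N. \<forall>n\<ge>N. K * (n + 1) ^ D \<le> pbar n"
proof -
  \<comment> \<open>For \<open>k\<close> the integer square root of \<open>n\<close>, the polynomial
    has degree \<open>2 * D\<close> in \<open>k\<close>. With \<open>t = k div E\<close>, the bound
    \<open>2 ^ k \<ge> (t + 1) ^ E\<close> has one spare factor \<open>t + 1\<close>, which beats
    the collected constants \<open>M\<close> once \<open>k \<ge> E * M\<close>.\<close>
  define E where "E = 2 * D + 1"
  define M where "M = K * E ^ (2 * D)"
  have "K * (n + 1) ^ D \<le> pbar n" if n: "(E * M)\<^sup>2 \<le> n" for n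
  proof -
    obtain k where k: "k\<^sup>2 \<le> n" "n < (k + 1)\<^sup>2" using ex_nat_sqrt by blast
    define t where "t = k div E"
    have "E > 0" by (simp add: E_def)
    have "(E * M)\<^sup>2 < (k + 1)\<^sup>2" using n k by linarith
    then have "E * M \<le> k" using power_less_imp_less_base[of "E * M" 2 "k + 1"] by simp
    then have t1: "M \<le> t" unfolding t_def using \<open>E > 0\<close>
      by (metis div_le_mono less_not_refl2 nonzero_mult_div_cancel_left)
    have k1: "k + 1 \<le> E * (t + 1)" 
      unfolding t_def using \<open>E > 0\<close> by (metis Suc_eq_plus1 Suc_leI dividend_less_times_div mult_Suc_right)
    have Et: "t * E \<le> k" by (simp add: t_def)
    have "K * (n + 1) ^ D \<le> K * ((k + 1)\<^sup>2) ^ D"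
      using k by (intro mult_left_mono power_mono) auto
    also have "\<dots> = K * (k + 1) ^ (2 * D)" by (simp add: power_mult)
    also have "\<dots> \<le> K * (E * (t + 1)) ^ (2 * D)"
      using k1 by (intro mult_left_mono power_mono) auto
    also have "\<dots> = M * (t + 1) ^ (2 * D)"
      by (simp only: M_def power_mult_distrib mult.assoc)
    also have "\<dots> \<le> (t + 1) * (t + 1) ^ (2 * D)" using t1 by (intro mult_right_mono) auto
    also have "\<dots> = (t + 1) ^ E" by (simp add: E_def)
    also have "\<dots> \<le> (2 ^ t) ^ E" 
      by (intro power_mono) (use less_exp[of t] in \<open>auto simp: Suc_le_eq\<close>)
    also have "\<dots> \<le> 2 ^ k" unfolding power_mult[symmetric] using Et by (intro power_increasing) auto
    also have "\<dots> \<le> pbar n" using power_two_le_pbar k(1) by blast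
    finally show ?thesis .
  qed
  then show ?thesis by blast
qed

text \<open>The order \<open>n1 \<le> n2\<close> makes the polynomial in front of
  \<open>pbar n1\<close> a polynomial in \<open>n2\<close>, which \<open>pbar n2\<close>
  outgrows.\<close>

lemma pbar_mult_dominates: "\<exists>N. \<forall>n1\<ge>N. \<forall>n2\<ge>n1. K * pbar (n1 + n2) \<le> pbar n1 * pbar n2"
proof (cases "K = 0")
  case False
  \<comment> \<open>The main term contributes 10 and each of the two error terms 1, so
    \<open>T = 12 * K\<close> leaves the factor \<open>K\<close>.\<close>
  define T q where "T = 12 * K" and "q = 8 * T + 8"
  have T: "T \<ge> 1" using False by (simp add: T_def)
  obtain N1 where N1: "\<And>n. n \<ge> N1 \<Longrightarrow> (T * 2 ^ q) * (n + 1) ^ (q + 2) \<le> pbar n"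
    using pbar_superpolynomial by blast
  obtain N2 where N2: "\<And>n. n \<ge> N2 \<Longrightarrow> (T * 2) * (n + 1) ^ 1 \<le> pbar n"
    using pbar_superpolynomial by blast
  have "K * pbar (n1 + n2) \<le> pbar n1 * pbar n2" if n: "n1 \<ge> max 1 (max N1 N2)" "n2 \<ge> n1" for n1 n2
  proof -
    have "(n1 + 1)\<^sup>2 * (n1 + n2 + 1) ^ q \<le> (n2 + 1)\<^sup>2 * (2 * (n2 + 1)) ^ q"
      using n by (intro mult_mono power_mono) auto
    also have "\<dots> = 2 ^ q * (n2 + 1) ^ (q + 2)"
      unfolding power_mult_distrib power_add by (simp only: ac_simps)
    finally have "T * ((n1 + 1)\<^sup>2 * (n1 + n2 + 1) ^ q) \<le> T * (2 ^ q * (n2 + 1) ^ (q + 2))"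
      by (rule mult_le_mono2)
    also have "\<dots> \<le> pbar n2" using N1[of n2] n by (simp add: mult.assoc)
    finally have 1: "T * ((n1 + 1)\<^sup>2 * (n1 + n2 + 1) ^ q) * pbar n1 \<le> pbar n2 * pbar n1"
      by (rule mult_le_mono1)
    have "T * (2 * (n1 + 1)) \<le> pbar n1" using N2[of n1] n by (simp add: mult.assoc)
    then have 2: "T * (2 * (n1 + 1)) * pbar n2 \<le> pbar n1 * pbar n2"
      by (rule mult_le_mono1)
    have n2: "n2 \<ge> 1" using n by simp
    have "T * pbar (n1 + n2) \<le> 12 * (pbar n1 * pbar n2)"
      using pbar_add_le[OF T n2, of n1] 1 2
      unfolding q_def[symmetric] mult.commute[of "pbar n2" "pbar n1"] by linarith
    then show ?thesis by (simp add: T_def)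
  qed
  then show ?thesis by blast
qed auto

text \<open>One more unit at most doubles every filler count, and the cores of the new weight add at
  most \<open>2 * pbar m\<close>.\<close>

lemma pbar_add_const_le: "pbar (n + k) \<le> 4 ^ k * pbar n"
proof (induction k)
  case (Suc k)
  have "pbar (Suc m) \<le> 4 * pbar m" for m
  proof -
    have "pbar (Suc m) = (\<Sum>i\<le>m. Suc ((Suc m - i) div 2) * num_cores i) + num_cores (Suc m)"
      unfolding pbar_eq_sum by simp
    also have "(\<Sum>i\<le>m. Suc ((Suc m - i) div 2) * num_cores i)
        \<le> (\<Sum>i\<le>m. 2 * (Suc ((m - i) div 2) * num_cores i))"
      unfolding mult.assoc[symmetric] by (intro sum_mono mult_right_mono) auto
    also have "\<dots> = 2 * pbar m" unfolding pbar_eq_sum by (simp only: sum_distrib_left)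
    finally show ?thesis using num_cores_Suc_le[of m] by simp
  qed
  from this[of "n + k"] Suc show ?case by simp
qed simp

section \<open>Reaching every rank class modulo \<open>c\<close>\<close>

text \<open>Two twos for one four keep the sum and the largest part and lower the rank by 1.\<close>

definition trade :: "nat \<Rightarrow> nat \<Rightarrow> overpartition \<Rightarrow> overpartition" where
  "trade c j p = (fst p + replicate_mset (c - j) 4 + replicate_mset (2 * j) 2, snd p)"

lemma M2_rank_trade:
  assumes "p \<in> overpartitions n" "j < c"
  shows "M2_rank (trade c j p) = M2_rank (trade c 0 p) - int j"
proof -
  obtain M S where p: "p = (M, S)" "S \<subseteq> set_mset M"
    using assms by (auto simp: overpartitions_def)
  have sub: "mset_set S \<subseteq># M" using mset_set_subseteq p(2) by blast
  \<comment> \<open>Because \<open>i < c\<close>, at least one four remains, so the added twos never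
    affect the maximum.\<close>
  have "Max (insert 0 (set_mset (fst (trade c i p)))) = Max (insert 4 (set_mset M))" if "i < c" for i
    using that by (intro Max_eq_if) (auto simp: trade_def p split: if_splits)
  then have largest: "largest_part (trade c j p) = largest_part (trade c 0 p)"
    using assms by (simp add: largest_part_def)
  have "nonoverlined_parts (trade c i p)
      = (M - mset_set S) + (replicate_mset (c - i) 4 + replicate_mset (2 * i) 2)" for i
    unfolding nonoverlined_parts_def trade_def p
    by (simp only: fst_conv snd_conv add.assoc subset_mset.add_diff_assoc2[OF sub])
  moreover have "filter_mset odd (replicate_mset i (4::nat)) = {#}" 
    "filter_mset odd (replicate_mset i (2::nat)) = {#}" for i
    by (auto simp: filter_mset_eq_conv)
  ultimately have "num_odd_nonoverlined (trade c i p) = size (filter_mset odd (M - mset_set S))" for i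
    by (simp add: num_odd_nonoverlined_def)
  moreover have "chi (trade c j p) = chi (trade c 0 p)"
    unfolding chi_def largest by (simp add: trade_def)
  moreover have "num_parts (trade c j p) = num_parts (trade c 0 p) + j"
    using assms by (simp add: num_parts_def trade_def)
  ultimately show ?thesis
    unfolding M2_rank_def largest by simp
qed

text \<open>Each overpartition has a trade that moves its rank into the class of \<open>a\<close>,
  and for fixed \<open>j\<close> the trade is injective; every trade adds weight
  \<open>4 * nat c\<close>.\<close>

lemma pbar_le_N2_bar:
  fixes a c :: int
  assumes "c > 0"
  shows "pbar n \<le> nat c * N2_bar a c (n + 4 * nat c)"
proof -
  define B where "B = {p \<in> overpartitions (n + 4 * nat c). [M2_rank p = a] (mod c)}"
  define A where "A = (\<lambda>j. {p \<in> overpartitions n. trade (nat c) j p \<in> B})"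
  have "overpartitions n \<subseteq> (\<Union>j<nat c. A j)"
  proof
    fix p assume p: "p \<in> overpartitions n"
    define r where "r = (M2_rank (trade (nat c) 0 p) - a) mod c"
    have r: "0 \<le> r" "r < c" using assms by (auto simp: r_def)
    then have j: "nat r < nat c" by simp
    have "[M2_rank (trade (nat c) 0 p) - a = r] (mod c)"
      by (simp add: r_def cong_def)
    then have "[M2_rank (trade (nat c) (nat r) p) = a] (mod c)"
      using r by (simp add: M2_rank_trade[OF p j] cong_iff_dvd_diff algebra_simps)
    moreover have "trade (nat c) (nat r) p \<in> overpartitions (n + 4 * nat c)"
      using p j by (auto simp: trade_def overpartitions_def split: if_splits)
    ultimately have "p \<in> A (nat r)" using p by (simp add: A_def B_def)
    then show "p \<in> (\<Union>j<nat c. A j)" using j by blast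
  qed
  then have "pbar n \<le> card (\<Union>j<nat c. A j)"
    by (intro card_mono) (auto simp: A_def finite_overpartitions)
  also have "\<dots> \<le> (\<Sum>j<nat c. card (A j))" by (intro card_UN_le) auto
  also have "\<dots> \<le> (\<Sum>j<nat c. card B)"
  proof (intro sum_mono card_inj_on_le)
    show "finite B" by (simp add: B_def finite_overpartitions)
    show "inj_on (trade (nat c) j) (A j)" for j
      by (auto simp: inj_on_def trade_def prod_eq_iff)
    show "trade (nat c) j ` A j \<subseteq> B" for j by (auto simp: A_def)
  qed
  finally show ?thesis by (simp add: B_def N2_bar_def)
qed

theorem theorem1p2:
  fixes a c :: int
  assumes "c \<ge> 2" and "odd c" and "0 \<le> a" and "a < c"
  shows "\<exists>N::nat. \<forall>n1\<ge>N. \<forall>n2\<ge>N. N2_bar a c n1 * N2_bar a c n2 > N2_bar a c (n1 + n2)"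
proof -
  define d where "d = nat c"
  define s where "s = 4 * d"
  have d: "d > 0" and lower: "pbar n \<le> d * N2_bar a c (n + s)" for n
    using assms pbar_le_N2_bar[of c n a] by (auto simp: d_def s_def)
  have upper: "N2_bar a c n \<le> pbar n" for n
    unfolding N2_bar_def by (intro card_mono finite_overpartitions) auto
  \<comment> \<open>The factor \<open>d * d\<close> pays for two uses of \<open>lower\<close>, the
    extra 1 yields strictness since \<open>pbar\<close> is positive, and \<open>4 ^ (2 * s)\<close>
    pays for the total shift \<open>2 * s\<close> of the arguments.\<close>
  obtain N where N: "\<And>n1 n2. n1 \<ge> N \<Longrightarrow> n2 \<ge> n1 \<Longrightarrow>
      ((d * d + 1) * 4 ^ (2 * s)) * pbar (n1 + n2) \<le> pbar n1 * pbar n2"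
    using pbar_mult_dominates by blast
  have main: "N2_bar a c (n1 + n2) < N2_bar a c n1 * N2_bar a c n2"
    if n: "n1 \<ge> N + s" "n2 \<ge> n1" for n1 n2
  proof -
    define m1 m2 where "m1 = n1 - s" and "m2 = n2 - s"
    have m: "n1 = m1 + s" "n2 = m2 + s" "m1 \<ge> N" "m2 \<ge> m1" "n1 + n2 = m1 + m2 + 2 * s"
      using n by (auto simp: m1_def m2_def)
    have "0 < pbar (n1 + n2)"
      using power_two_le_pbar[of 0 "n1 + n2"] by simp
    then have "d * d * N2_bar a c (n1 + n2) < (d * d + 1) * pbar (n1 + n2)"
      using mult_le_mono2[OF upper[of "n1 + n2"], of "d * d"] by (simp only: distrib_right)
    also have "\<dots> \<le> (d * d + 1) * (4 ^ (2 * s) * pbar (m1 + m2))"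
      unfolding m(5) by (intro mult_left_mono pbar_add_const_le) auto
    also have "\<dots> \<le> pbar m1 * pbar m2" using N[OF m(3,4)] by (simp only: mult.assoc)
    also have "\<dots> \<le> (d * N2_bar a c n1) * (d * N2_bar a c n2)"
      unfolding m(1,2) by (intro mult_mono lower) auto
    also have "\<dots> = d * d * (N2_bar a c n1 * N2_bar a c n2)" by (simp only: ac_simps)
    finally show ?thesis using d by simp
  qed
  have "N2_bar a c n1 * N2_bar a c n2 > N2_bar a c (n1 + n2)"
    if "n1 \<ge> N + s" "n2 \<ge> N + s" for n1 n2
    using main[of n1 n2] main[of n2 n1] that by (cases "n1 \<le> n2") (auto simp: ac_simps)
  then show ?thesis by blast
qed

end
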